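(* For $i\in\{1,2,3,4,5\}$ let $(P_i)$ denote the $i$-th of the five notions of periodicity of a point of a nonautonomous dynamical system listed in the context. For a class of nonautonomous dynamical systems and $i\neq j$, say that $(P_i)$ implies $(P_j)$ in this class if for every system $(X,f_{1,\infty})$ in the class, every $x\in X$ satisfying $(P_i)$ satisfies $(P_j)$; otherwise (that is, if there are a system $(X,f_{1,\infty})$ in the class and a point $x\in X$ satisfying $(P_i)$ but not $(P_j)$) say that $(P_i)$ does not imply $(P_j)$ in the class. (a) In the class of all nonautonomous dynamical systems: $(P_2)$ implies $(P_1)$, $(P_4)$ and $(P_5)$; $(P_4)$ implies $(P_3)$ (hence also $(P_2)$ implies $(P_3)$); and no other implication holds, i.e. $(P_1)$ implies none of $(P_2),(P_3),(P_4),(P_5)$; $(P_3)$ implies none of $(P_1),(P_2),(P_4),(P_5)$; $(P_4)$ implies none of $(P_1),(P_2),(P_5)$; $(P_5)$ implies none of $(P_1),(P_2),(P_3),(P_4)$. (b) In the class of all uniformly converging nonautonomous dynamical systems: $(P_2)$ implies $(P_1)$ and $(P_4)$; $(P_4)$ implies $(P_1)$, $(P_3)$ and $(P_5)$ (hence also $(P_2)$ implies $(P_3)$ and $(P_5)$); and no other implication holds, i.e. $(P_1)$ implies none of $(P_2),(P_3),(P_4),(P_5)$; $(P_3)$ implies none of $(P_1),(P_2),(P_4),(P_5)$; $(P_4)$ does not imply $(P_2)$; $(P_5)$ implies none of $(P_1),(P_2),(P_3),(P_4)$.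
   Context: $\mathbb{N}$ is the set of positive integers. A nonautonomous dynamical system (NDS) is a pair $(X,f_{1,\infty})$ where $X$ is a compact metric space with metric $d$ and $f_{1,\infty}=\{f_i\}_{i=1}^\infty$ is a sequence of continuous surjective maps $f_i:X\to X$. For $i,n\in\mathbb{N}$ put $f_i^0=\mathrm{id}_X$ and $f_i^n=f_{i+(n-1)}\circ\cdots\circ f_{i+1}\circ f_i$. The NDS is uniformly converging if the sequence $\{f_n\}$ converges uniformly on $X$ to a continuous map $f:X\to X$. The five notions of periodicity of a point $x\in X$ are: $(P_1)$ ($x$ is pseudo-periodic): there exist $r\in\mathbb{N}$ and points $x_1=x,x_2,\dots,x_r\in X$ such that for any $\varepsilon>0$ there is $N\in\mathbb{N}$ such that for all $n\geq N$: $d(f_{nr+i}(x_i),x_{i+1})<\varepsilon$ for $1\leq i<r$, and $d(f_{nr}(x_r),x_1)<\varepsilon$. (Here $f_{nr+i}$ denotes a single map of the sequence.) $(P_2)$: there is $r\in\mathbb{N}$ such that $f_1^{n+r}(x)=f_1^n(x)$ for all $n\geq 0$. $(P_3)$: there is $n\in\mathbb{N}$ such that $f_1^n(x)=x$. $(P_4)$: there is $r\in\mathbb{N}$ such that $f_1^{rn}(x)=x$ for all $n\in\mathbb{N}$. $(P_5)$ ($x$ is asymptotically periodic): there exist $r\in\mathbb{N}$ and points $x_1,\dots,x_r\in X$ such that for any $\varepsilon>0$ there is $n_0>0$ such that $d(f_1^{nr+i}(x),x_{i+1})<\varepsilon$ for all $n\geq n_0$ and $0\leq i<r$. *)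

theory Defs
  imports "HOL-Analysis.Analysis"
begin

(* Each system carries its own carrier set and metric, so that "all systems" can be
   quantified over inside the logic. Only the maps with index at least 1, restricted to the
   carrier, are relevant.

   The carrier is a subset of a type 'a. A compact metric space has at most the cardinality
   of the continuum, so it is isometric to a subset of the type real with a suitable (in general
   not the usual) metric. Hence the systems of type "real nds" represent all systems up to
   isometry, and a non-implication is a statement about "real nds". *)

record 'a nds =
  pts :: "'a set"
  metr :: "'a \<Rightarrow> 'a \<Rightarrow> real"
  maps :: "nat \<Rightarrow> 'a \<Rightarrow> 'a"

abbreviation nds_top :: "'a nds \<Rightarrow> 'a topology" where
  "nds_top S \<equiv> Metric_space.mtopology (pts S) (metr S)"

definition all_nds :: "'a nds set" where
  "all_nds = {S. Metric_space (pts S) (metr S) \<and> compact_space (nds_top S) \<and>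
     (\<forall>i\<ge>1. continuous_map (nds_top S) (nds_top S) (maps S i) \<and> maps S i ` pts S = pts S)}"

definition unif_conv_nds :: "'a nds set" where
  "unif_conv_nds = {S \<in> all_nds. \<exists>g. continuous_map (nds_top S) (nds_top S) g \<and>
     (\<forall>e>0. \<exists>N\<ge>1. \<forall>n\<ge>N. \<forall>x\<in>pts S. metr S (maps S n x) (g x) < e)}"

(* nds_iter f i n is the paper's f_i^n, i.e. f (i + n - 1) o ... o f (i + 1) o f i. *)
primrec nds_iter :: "(nat \<Rightarrow> 'a \<Rightarrow> 'a) \<Rightarrow> nat \<Rightarrow> nat \<Rightarrow> 'a \<Rightarrow> 'a" where
  "nds_iter f i 0 = id"
| "nds_iter f i (Suc n) = f (i + n) \<circ> nds_iter f i n"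

definition P1 :: "'a nds \<Rightarrow> 'a \<Rightarrow> bool" where
  "P1 S x \<longleftrightarrow> (\<exists>r\<ge>1. \<exists>y :: nat \<Rightarrow> 'a. y 1 = x \<and> (\<forall>i\<in>{1..r}. y i \<in> pts S) \<and>
     (\<forall>e>0. \<exists>N\<ge>1. \<forall>n\<ge>N.
        (\<forall>i. 1 \<le> i \<and> i < r \<longrightarrow> metr S (maps S (n * r + i) (y i)) (y (i + 1)) < e) \<and>
        metr S (maps S (n * r) (y r)) (y 1) < e))"

definition P2 :: "'a nds \<Rightarrow> 'a \<Rightarrow> bool" where
  "P2 S x \<longleftrightarrow> (\<exists>r\<ge>1. \<forall>n\<ge>0. nds_iter (maps S) 1 (n + r) x = nds_iter (maps S) 1 n x)"

definition P3 :: "'a nds \<Rightarrow> 'a \<Rightarrow> bool" where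
  "P3 S x \<longleftrightarrow> (\<exists>n\<ge>1. nds_iter (maps S) 1 n x = x)"

definition P4 :: "'a nds \<Rightarrow> 'a \<Rightarrow> bool" where
  "P4 S x \<longleftrightarrow> (\<exists>r\<ge>1. \<forall>n\<ge>1. nds_iter (maps S) 1 (r * n) x = x)"

definition P5 :: "'a nds \<Rightarrow> 'a \<Rightarrow> bool" where
  "P5 S x \<longleftrightarrow> (\<exists>r\<ge>1. \<exists>y :: nat \<Rightarrow> 'a. (\<forall>i\<in>{1..r}. y i \<in> pts S) \<and>
     (\<forall>e>0. \<exists>n0>0. \<forall>n\<ge>n0. \<forall>i<r.
        metr S (nds_iter (maps S) 1 (n * r + i) x) (y (i + 1)) < e))"

definition implies_in ::
  "'a nds set \<Rightarrow> ('a nds \<Rightarrow> 'a \<Rightarrow> bool) \<Rightarrow> ('a nds \<Rightarrow> 'a \<Rightarrow> bool) \<Rightarrow> bool" where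
  "implies_in C P Q \<longleftrightarrow> (\<forall>S\<in>C. \<forall>x\<in>pts S. P S x \<longrightarrow> Q S x)"

end

theory Submission
  imports Defs "HOL-Real_Asymp.Real_Asymp"
begin

text \<open>
Implications. If \<^term>\<open>P2\<close> holds with period \<open>r\<close>, the orbit is literally periodic, and its first
\<open>r\<close> points witness \<^term>\<open>P1\<close> and \<^term>\<open>P5\<close> with error zero, while
its returns at the multiples of \<open>r\<close> are \<^term>\<open>P4\<close>; \<^term>\<open>P4\<close> contains \<^term>\<open>P3\<close>
as its first return. If the maps converge uniformly to \<open>g\<close> and \<open>x\<close> returns at all multiples of
\<open>r\<close>, then the orbit piece that starts at time \<open>n * r\<close> starts at \<open>x\<close> again but uses later and later
maps, so it converges to the \<open>g\<close>-orbit of \<open>x\<close> (\<open>returning_orbit_tends_to_limit_orbit\<close>). At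
offset \<open>r\<close> the piece is back at \<open>x\<close>, hence \<open>(g ^^ r) x = x\<close>, and the points
\<open>(g ^^ i) x\<close> witness both \<^term>\<open>P1\<close> and \<^term>\<open>P5\<close>.

Non-implications. \<^term>\<open>P2\<close> to \<^term>\<open>P5\<close> speak about one orbit only, so it suffices to choose a sequence \<open>c\<close> in
the open unit interval and to realise it as an orbit. The surjections
\<open>x + t * (x * (1 - x))\<close> of the unit interval with \<open>\<bar>t\<bar> \<le> 1\<close> do this: one real parameter
moves a given interior point to any target in a certain neighbourhood of it. The system \<open>steer c\<close> uses
the parameters that make \<open>c\<close> the orbit of \<open>c 0\<close>. It converges uniformly as soon as the parameters
converge; when they tend to 0 the limit is the identity, for which every point is fixed, and so
\<^term>\<open>P1\<close> holds everywhere. Five sequences give all separations: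
\<^item> jump once and stay: \<^term>\<open>P1\<close> and \<^term>\<open>P5\<close> without \<^term>\<open>P3\<close>;
\<^item> return once and then oscillate ever more slowly without settling (\<open>log_wave\<close>): \<^term>\<open>P1\<close> and
  \<^term>\<open>P3\<close> without \<^term>\<open>P5\<close>;
\<^item> return once and then iterate the squaring map from 1/2: \<^term>\<open>P3\<close> and \<^term>\<open>P5\<close> without \<^term>\<open>P1\<close>;
\<^item> rest at 1/2 at even times, with excursions shrinking to 0 at odd times: \<^term>\<open>P4\<close> without \<^term>\<open>P2\<close>;
\<^item> rest at 1/2 at even times, with the values of \<open>log_wave\<close> at odd times: \<^term>\<open>P4\<close> without \<^term>\<open>P1\<close>
  and without \<^term>\<open>P5\<close>.

All but the last converge uniformly, as they must, since \<^term>\<open>P4\<close> implies \<^term>\<open>P1\<close> and \<^term>\<open>P5\<close> under uniform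
convergence. The remaining entries of the two tables follow from these by transitivity and by
passing to the larger class.
\<close>

section \<open>Implications valid in every system\<close>

lemma all_nds_maps_in_pts:
  assumes "S \<in> all_nds" "i \<ge> 1" "x \<in> pts S"
  shows "maps S i x \<in> pts S"
  using assms unfolding all_nds_def by blast

lemma nds_iter_in_pts:
  assumes "S \<in> all_nds" "x \<in> pts S"
  shows "nds_iter (maps S) 1 n x \<in> pts S"
  by (induction n) (auto simp: assms all_nds_maps_in_pts[OF assms(1)])

lemma all_nds_metr_self:
  assumes "S \<in> all_nds" "x \<in> pts S"
  shows "metr S x x = 0"
proof -
  interpret Metric_space "pts S" "metr S"
    using assms(1) by (simp add: all_nds_def)
  show ?thesis using assms(2) by simp
qed

lemma periodic_orbit_mult:
  assumes "\<forall>n\<ge>0. nds_iter (maps S) 1 (n + r) x = nds_iter (maps S) 1 n x"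
  shows "nds_iter (maps S) 1 (m * r + i) x = nds_iter (maps S) 1 i x"
proof (induction m)
  case (Suc m)
  have "Suc m * r + i = (m * r + i) + r" by simp
  then show ?case using assms Suc by (metis zero_le)
qed simp

lemma P2_imp_P4: "P2 S x \<Longrightarrow> P4 S x"
  unfolding P2_def P4_def
  by (metis (no_types) periodic_orbit_mult[of S _ x _ 0] add_0_right id_apply mult.commute nds_iter.simps(1))

lemma P4_imp_P3: "P4 S x \<Longrightarrow> P3 S x"
  unfolding P4_def P3_def by (metis le_refl mult.right_neutral)

lemma P2_imp_P5:
  assumes S: "S \<in> all_nds" "x \<in> pts S" and "P2 S x"
  shows "P5 S x"
proof -
  obtain r where r: "r \<ge> 1"
    "\<forall>n\<ge>0. nds_iter (maps S) 1 (n + r) x = nds_iter (maps S) 1 n x"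
    using assms(3) unfolding P2_def by blast
  show ?thesis
    unfolding P5_def periodic_orbit_mult[OF r(2)]
    using r(1) nds_iter_in_pts[OF S] all_nds_metr_self[OF S(1) nds_iter_in_pts[OF S]]
    by (intro exI[of _ r] conjI exI[of _ "\<lambda>i. nds_iter (maps S) 1 (i - 1) x"])
      (auto simp: periodic_orbit_mult[OF r(2)] simp del: One_nat_def intro!: exI[of _ "1::nat"])
qed

text \<open>The maps at times \<open>n * r + i\<close> act on the same orbit point for every \<open>n\<close>, so the points of one
period satisfy the pseudo-periodicity conditions with equality. The wrap-around condition, which
concerns the map at time \<open>n * r\<close>, is the last step of the period before it and so needs \<open>n \<ge> 1\<close>.\<close>

lemma P2_imp_P1:
  assumes S: "S \<in> all_nds" "x \<in> pts S" and "P2 S x"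
  shows "P1 S x"
proof -
  let ?y = "\<lambda>i. nds_iter (maps S) 1 (i - 1) x"
  obtain r where r: "r \<ge> 1"
    "\<forall>n\<ge>0. nds_iter (maps S) 1 (n + r) x = nds_iter (maps S) 1 n x"
    using assms(3) unfolding P2_def by blast
  have step: "maps S (n * r + i) (?y i) = nds_iter (maps S) 1 i x" if "i \<ge> 1" for n i
  proof -
    obtain j where j: "i = Suc j" using \<open>i \<ge> 1\<close> by (cases i) auto
    have "maps S (n * r + i) (nds_iter (maps S) 1 (n * r + j) x) = nds_iter (maps S) 1 (n * r + i) x"
      by (simp add: j)
    then show ?thesis unfolding periodic_orbit_mult[OF r(2)] by (simp add: j)
  qed
  have last: "maps S (n * r) (?y r) = x" if "n \<ge> 1" for n
  proof -
    obtain m where m: "n = Suc m" using \<open>n \<ge> 1\<close> by (cases n) auto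
    show ?thesis
      using step[OF r(1), of m] r(2)[rule_format, of 0] by (simp add: m add.commute)
  qed
  show ?thesis
    unfolding P1_def
    using r(1) step last nds_iter_in_pts[OF S] all_nds_metr_self[OF S(1) nds_iter_in_pts[OF S]]
      all_nds_metr_self[OF S]
    by (intro exI[of _ r] exI[of _ ?y] conjI allI impI exI[of _ "1::nat"]) auto
qed

section \<open>Return times in uniformly converging systems\<close>

text \<open>By induction on the offset \<open>j\<close>: the next map is uniformly close to \<open>g\<close>, and \<open>g\<close> is continuous at
the limit found for offset \<open>j\<close>. The return hypothesis is what makes offset 0 converge.\<close>

lemma returning_orbit_tends_to_limit_orbit:
  assumes S: "S \<in> all_nds" "x \<in> pts S"
    and g: "continuous_map (nds_top S) (nds_top S) g"
    and unif: "\<forall>e>0. \<exists>N\<ge>1. \<forall>n\<ge>N. \<forall>x\<in>pts S. metr S (maps S n x) (g x) < e"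
    and r: "r \<ge> 1" "\<And>n. nds_iter (maps S) 1 (r * n) x = x"
  shows "limitin (nds_top S) (\<lambda>n. nds_iter (maps S) 1 (n * r + j) x) ((g ^^ j) x) sequentially"
proof -
  interpret Metric_space "pts S" "metr S"
    using S(1) by (simp add: all_nds_def)
  show ?thesis
  proof (induction j)
    case 0
    show ?case using r(2) S(2) by (simp add: mult.commute)
  next
    case (Suc j)
    let ?u = "\<lambda>n. nds_iter (maps S) 1 (n * r + j) x"
    let ?v = "\<lambda>n. nds_iter (maps S) 1 (n * r + Suc j) x"
    have u: "?u n \<in> pts S" and v: "?v n \<in> pts S" for n
      by (rule nds_iter_in_pts[OF S])+
    have gu: "g z \<in> pts S" if "z \<in> pts S" for z
      using continuous_map_image_subset_topspace[OF g] that by auto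
    have lim: "limitin (nds_top S) (g \<circ> ?u) (g ((g ^^ j) x)) sequentially"
      by (rule continuous_map_limit[OF g Suc])
    show ?case
      unfolding limit_metric_sequentially
    proof (intro conjI allI impI)
      show *: "(g ^^ Suc j) x \<in> pts S"
        using lim limitin_mspace by auto
      fix e :: real assume "e > 0"
      then have e: "e / 2 > 0" by simp
      obtain N1 where N1: "\<forall>n\<ge>N1. metr S (g (?u n)) (g ((g ^^ j) x)) < e / 2"
        using lim e unfolding limit_metric_sequentially o_def by blast
      obtain N2 where N2: "\<forall>n\<ge>N2. \<forall>x\<in>pts S. metr S (maps S n x) (g x) < e / 2"
        using unif e by blast
      have "metr S (?v n) ((g ^^ Suc j) x) < e" if "n \<ge> max N1 N2" for n
      proof -
        have "n \<le> n * r" using r(1) by simp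
        then have "N2 \<le> 1 + (n * r + j)" using that by linarith
        then have "metr S (?v n) (g (?u n)) < e / 2"
          using N2 u[of n] by simp
        moreover have "metr S (g (?u n)) (g ((g ^^ j) x)) < e / 2"
          using N1 that by simp
        moreover have "metr S (?v n) (g ((g ^^ j) x))
            \<le> metr S (?v n) (g (?u n)) + metr S (g (?u n)) (g ((g ^^ j) x))"
          using limitin_mspace[OF Suc] by (intro triangle v gu u)
        ultimately show ?thesis by simp
      qed
      then show "\<exists>N. \<forall>n\<ge>N. ?v n \<in> pts S \<and> metr S (?v n) ((g ^^ Suc j) x) < e"
        using v by blast
    qed
  qed
qed

text \<open>At offset \<open>r\<close> the convergent sequence is constantly \<open>x\<close>, so uniqueness of limits makes \<open>x\<close> a
periodic point of the limit map.\<close>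

lemma unif_conv_P4_limit:
  assumes "S \<in> unif_conv_nds" "x \<in> pts S" "P4 S x"
  obtains g r where "r \<ge> 1" "(g ^^ r) x = x" "\<And>j. (g ^^ j) x \<in> pts S"
    "\<forall>e>0. \<exists>N\<ge>1. \<forall>n\<ge>N. \<forall>x\<in>pts S. metr S (maps S n x) (g x) < e"
    "\<And>j. limitin (nds_top S) (\<lambda>n. nds_iter (maps S) 1 (n * r + j) x) ((g ^^ j) x) sequentially"
proof -
  have S: "S \<in> all_nds" using assms(1) by (simp add: unif_conv_nds_def)
  interpret Metric_space "pts S" "metr S"
    using S by (simp add: all_nds_def)
  obtain g where g: "continuous_map (nds_top S) (nds_top S) g"
    and unif: "\<forall>e>0. \<exists>N\<ge>1. \<forall>n\<ge>N. \<forall>x\<in>pts S. metr S (maps S n x) (g x) < e"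
    using assms(1) by (auto simp: unif_conv_nds_def)
  obtain r where r: "r \<ge> 1" "\<forall>n\<ge>1. nds_iter (maps S) 1 (r * n) x = x"
    using assms(3) by (auto simp: P4_def)
  have ret: "nds_iter (maps S) 1 (r * n) x = x" for n
    using r(2) by (cases n) auto
  note lim = returning_orbit_tends_to_limit_orbit[OF S assms(2) g unif r(1) ret]
  have "nds_iter (maps S) 1 (n * r + r) x = x" for n
    using ret[of "Suc n"] by (simp add: algebra_simps)
  then have "limitin (nds_top S) (\<lambda>n. x) ((g ^^ r) x) sequentially"
    using lim[of r] by simp
  moreover have "limitin (nds_top S) (\<lambda>n. x) x sequentially"
    using assms(2) by simp
  ultimately have "(g ^^ r) x = x"
    using limitin_metric_unique trivial_limit_sequentially by blast
  then show thesis
    using limitin_mspace[OF lim] by (rule that[OF r(1) _ _ unif lim])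
qed

lemma unif_conv_P4_imp_P1:
  assumes "S \<in> unif_conv_nds" "x \<in> pts S" "P4 S x"
  shows "P1 S x"
proof -
  obtain g r where r: "r \<ge> 1" "(g ^^ r) x = x" and gin: "\<And>j. (g ^^ j) x \<in> pts S"
    and unif: "\<forall>e>0. \<exists>N\<ge>1. \<forall>n\<ge>N. \<forall>x\<in>pts S. metr S (maps S n x) (g x) < e"
    and "\<And>j. limitin (nds_top S) (\<lambda>n. nds_iter (maps S) 1 (n * r + j) x) ((g ^^ j) x) sequentially"
    by (rule unif_conv_P4_limit[OF assms]) (rule that)
  let ?y = "\<lambda>i. (g ^^ (i - 1)) x"
  have gy: "g (?y i) = (g ^^ i) x" if "i \<ge> 1" for i
    using that by (cases i) auto
  have "\<exists>N\<ge>1. \<forall>n\<ge>N.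
        (\<forall>i. 1 \<le> i \<and> i < r \<longrightarrow> metr S (maps S (n * r + i) (?y i)) (?y (i + 1)) < e) \<and>
        metr S (maps S (n * r) (?y r)) (?y 1) < e" if "e > 0" for e
  proof -
    obtain N where N: "N \<ge> 1" "\<forall>n\<ge>N. \<forall>x\<in>pts S. metr S (maps S n x) (g x) < e"
      using unif \<open>e > 0\<close> by blast
    have le_mult: "N \<le> n * r" if "n \<ge> N" for n
      using mult_le_mono[OF that r(1)] by simp
    have N': "metr S (maps S m (?y i)) (g (?y i)) < e" if "m \<ge> N" for m i
      using N(2) gin that by blast
    show ?thesis
    proof (intro exI[of _ N] conjI allI impI)
      fix n assume "N \<le> n"
      then have le: "N \<le> n * r" by (rule le_mult)
      show "metr S (maps S (n * r) (?y r)) (?y 1) < e"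
        using N'[OF le, of r] unfolding gy[OF r(1)] r(2) by simp
      fix i assume i: "1 \<le> i \<and> i < r"
      show "metr S (maps S (n * r + i) (?y i)) (?y (i + 1)) < e"
        using N'[of "n * r + i" i] gy[of i] i le by simp
    qed (rule N(1))
  qed
  then show ?thesis
    unfolding P1_def using r(1) gin
    by (intro exI[of _ r] exI[of _ ?y] conjI) simp_all
qed

lemma unif_conv_P4_imp_P5:
  assumes "S \<in> unif_conv_nds" "x \<in> pts S" "P4 S x"
  shows "P5 S x"
proof -
  obtain g r where r: "r \<ge> 1" and "(g ^^ r) x = x" and gin: "\<And>j. (g ^^ j) x \<in> pts S"
    and "\<forall>e>0. \<exists>N\<ge>1. \<forall>n\<ge>N. \<forall>x\<in>pts S. metr S (maps S n x) (g x) < e"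
    and lim: "\<And>j. limitin (nds_top S) (\<lambda>n. nds_iter (maps S) 1 (n * r + j) x) ((g ^^ j) x) sequentially"
    by (rule unif_conv_P4_limit[OF assms]) (rule that)
  interpret Metric_space "pts S" "metr S"
    using assms(1) by (simp add: unif_conv_nds_def all_nds_def)
  have "\<exists>n0>0. \<forall>n\<ge>n0. \<forall>i<r.
        metr S (nds_iter (maps S) 1 (n * r + i) x) ((g ^^ (i + 1 - 1)) x) < e" if "e > 0" for e
  proof -
    have "eventually (\<lambda>n. metr S (nds_iter (maps S) 1 (n * r + i) x) ((g ^^ i) x) < e) sequentially" for i
    proof -
      have "eventually (\<lambda>n. nds_iter (maps S) 1 (n * r + i) x \<in> pts S \<and>
          metr S (nds_iter (maps S) 1 (n * r + i) x) ((g ^^ i) x) < e) sequentially"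
        using lim[of i] \<open>e > 0\<close> by (simp only: limitin_metric)
      then show ?thesis by (rule eventually_mono) (rule conjunct2)
    qed
    then have "eventually (\<lambda>n. \<forall>i\<in>{..<r}. metr S (nds_iter (maps S) 1 (n * r + i) x) ((g ^^ i) x) < e) sequentially"
      by (intro eventually_ball_finite) auto
    then have "eventually (\<lambda>n. n > 0 \<and> (\<forall>i\<in>{..<r}. metr S (nds_iter (maps S) 1 (n * r + i) x) ((g ^^ i) x) < e)) sequentially"
      using eventually_gt_at_top by (rule eventually_conj[rotated])
    then obtain N where N: "\<forall>n\<ge>N. n > 0 \<and> (\<forall>i\<in>{..<r}. metr S (nds_iter (maps S) 1 (n * r + i) x) ((g ^^ i) x) < e)"
      unfolding eventually_sequentially by blast
    then show ?thesis
      unfolding add_diff_cancel_right' by (intro exI[of _ N]) simp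
  qed
  then show ?thesis
    unfolding P5_def using r gin
    by (intro exI[of _ r] exI[of _ "\<lambda>i. (g ^^ (i - 1)) x"] conjI) simp_all
qed

section \<open>Interval systems with a prescribed orbit\<close>

text \<open>The solution \<open>t\<close> of \<open>a + t * (a * (1 - a)) = b\<close>, where \<open>a\<close> and \<open>b\<close> are the terms of \<open>c\<close> before and
after step \<open>n\<close>. At index 0 the truncated subtraction gives the value 0.\<close>

definition steer_coeff :: "(nat \<Rightarrow> real) \<Rightarrow> nat \<Rightarrow> real" where
  "steer_coeff c n = (c n - c (n - 1)) / (c (n - 1) * (1 - c (n - 1)))"

definition steer :: "(nat \<Rightarrow> real) \<Rightarrow> real nds" where
  "steer c = \<lparr>pts = {0..1}, metr = dist, maps = (\<lambda>n x. x + steer_coeff c n * (x * (1 - x)))\<rparr>"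

text \<open>The inequality says that the parameters of the maps have absolute value at most 1, the range in which
these maps send the unit interval onto itself.\<close>

definition steerable :: "(nat \<Rightarrow> real) \<Rightarrow> bool" where
  "steerable c \<longleftrightarrow> (\<forall>n. 0 < c n \<and> c n < 1 \<and> \<bar>c (Suc n) - c n\<bar> \<le> c n * (1 - c n))"

lemma steer_simps [simp]:
  "pts (steer c) = {0..1}" "metr (steer c) = dist"
  "maps (steer c) n x = x + steer_coeff c n * (x * (1 - x))"
  by (simp_all add: steer_def)

lemma steer_maps: "maps (steer c) n = (\<lambda>x. x + steer_coeff c n * (x * (1 - x)))"
  by (simp add: steer_def)

lemma steer_Metric_space: "Metric_space {0..1::real} dist"
  by (rule Met_TC.subspace) simp

lemma steer_top [simp]: "nds_top (steer c) = top_of_set {0..1}"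
proof -
  interpret Submetric UNIV dist "{0..1::real}"
    by unfold_locales simp
  show ?thesis using mtopology_submetric by simp
qed

lemma steer_coeff_bound:
  assumes "steerable c" "n \<ge> 1"
  shows "\<bar>steer_coeff c n\<bar> \<le> 1"
proof -
  obtain m where m: "n = Suc m" using assms(2) by (cases n) auto
  have "0 < c m * (1 - c m)" "\<bar>c (Suc m) - c m\<bar> \<le> c m * (1 - c m)"
    using assms(1) by (auto simp: steerable_def)
  then show ?thesis by (simp add: m steer_coeff_def abs_divide abs_of_pos)
qed

text \<open>The perturbation never exceeds the distance to either end point, so the interval is mapped into
itself; both end points are fixed, so the intermediate value theorem gives surjectivity.\<close>

lemma logistic_perturbation_image:
  fixes t :: real
  assumes "\<bar>t\<bar> \<le> 1"
  shows "(\<lambda>x. x + t * (x * (1 - x))) ` {0..1} = {0..1}"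
proof
  let ?f = "\<lambda>x. x + t * (x * (1 - x))"
  show "?f ` {0..1} \<subseteq> {0..1}"
  proof clarify
    fix x :: real assume x: "x \<in> {0..1}"
    then have p: "0 \<le> x * (1 - x)" by simp
    have "\<bar>t * (x * (1 - x))\<bar> \<le> x * (1 - x)"
      using mult_right_mono[OF assms p] p by (simp only: abs_mult[of t] abs_of_nonneg mult_1_left)
    moreover have "x * (1 - x) \<le> x" "x * (1 - x) \<le> 1 - x"
      using x by (auto intro: mult_left_le mult_left_le_one_le)
    ultimately show "?f x \<in> {0..1}" by (auto simp: abs_le_iff)
  qed
  show "{0..1} \<subseteq> ?f ` {0..1}"
  proof
    fix y :: real assume y: "y \<in> {0..1}"
    have "continuous_on {0..1} ?f" by (intro continuous_intros)
    then obtain x where "0 \<le> x" "x \<le> 1" "?f x = y"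
      using IVT'[of ?f 0 y 1] y by auto
    then show "y \<in> ?f ` {0..1}" by auto
  qed
qed

lemma continuous_map_logistic_perturbation:
  fixes t :: real
  assumes "\<bar>t\<bar> \<le> 1"
  shows "continuous_map (top_of_set {0..1}) (top_of_set {0..1}) (\<lambda>x. x + t * (x * (1 - x)))"
  using logistic_perturbation_image[OF assms]
  by (auto simp: continuous_map_in_subtopology continuous_map_iff_continuous
      intro!: continuous_intros)

lemma steer_in_all_nds:
  assumes "steerable c"
  shows "steer c \<in> all_nds"
proof -
  have "compact_space (top_of_set {0..1::real})"
    by (simp add: compact_space_subtopology)
  then show ?thesis
    unfolding all_nds_def mem_Collect_eq steer_top
    using steer_coeff_bound[OF assms] logistic_perturbation_image
      continuous_map_logistic_perturbation steer_Metric_space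
    unfolding steer_simps steer_maps by blast
qed

text \<open>Since \<open>x * (1 - x) \<le> 1\<close> on the unit interval, two of the maps differ at most by the difference of
their parameters.\<close>

lemma steer_in_unif_conv_nds:
  assumes c: "steerable c" and t: "steer_coeff c \<longlonglongrightarrow> t"
  shows "steer c \<in> unif_conv_nds"
proof -
  let ?g = "\<lambda>x. x + t * (x * (1 - x))"
  have "\<bar>t\<bar> \<le> 1"
    using tendsto_rabs[OF t] steer_coeff_bound[OF c] by (intro LIMSEQ_le_const2) auto
  then have g: "continuous_map (top_of_set {0..1}) (top_of_set {0..1}) ?g"
    by (rule continuous_map_logistic_perturbation)
  have "\<exists>N\<ge>1. \<forall>n\<ge>N. \<forall>x\<in>{0..1}. dist (x + steer_coeff c n * (x * (1 - x))) (?g x) < e"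
    if "e > 0" for e
  proof -
    obtain N where N: "\<forall>n\<ge>N. dist (steer_coeff c n) t < e"
      using t \<open>e > 0\<close> by (auto simp: lim_sequentially)
    have "dist (x + steer_coeff c n * (x * (1 - x))) (?g x) < e"
      if "n \<ge> N" "x \<in> {0..1}" for n x
    proof -
      have x: "0 \<le> x * (1 - x)" "x * (1 - x) \<le> 1"
        using that(2) by (auto intro: mult_le_one)
      have "dist (x + steer_coeff c n * (x * (1 - x))) (?g x) = \<bar>(steer_coeff c n - t) * (x * (1 - x))\<bar>"
        by (simp add: dist_real_def algebra_simps)
      also have "\<dots> = \<bar>steer_coeff c n - t\<bar> * (x * (1 - x))"
        using x(1) by (simp only: abs_mult[of "steer_coeff c n - t"] abs_of_nonneg)
      also have "\<dots> \<le> \<bar>steer_coeff c n - t\<bar> * 1"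
        using x by (intro mult_left_mono) auto
      also have "\<dots> < e" using N that(1) by (simp add: dist_real_def)
      finally show ?thesis .
    qed
    then show ?thesis by (intro exI[of _ "max N 1"]) auto
  qed
  then have "\<forall>e>0. \<exists>N\<ge>1. \<forall>n\<ge>N. \<forall>x\<in>pts (steer c). metr (steer c) (maps (steer c) n x) (?g x) < e"
    unfolding steer_simps by (intro allI impI)
  moreover have "continuous_map (nds_top (steer c)) (nds_top (steer c)) ?g"
    using g by (simp only: steer_top)
  ultimately show ?thesis
    unfolding unif_conv_nds_def mem_Collect_eq
    by (intro conjI steer_in_all_nds[OF c] exI[of _ ?g])
qed

lemma steer_maps_orbit:
  assumes "steerable c"
  shows "maps (steer c) (Suc n) (c n) = c (Suc n)"
proof -
  have "0 < c n * (1 - c n)" using assms by (auto simp: steerable_def)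
  then have "c n \<noteq> 0" "1 - c n \<noteq> 0" by auto
  then show ?thesis by (simp add: steer_coeff_def)
qed

lemma steer_orbit:
  assumes "steerable c"
  shows "nds_iter (maps (steer c)) 1 n (c 0) = c n"
proof (induction n)
  case (Suc n)
  then show ?case using steer_maps_orbit[OF assms] by (simp del: steer_simps)
qed simp

lemma steer_start: "steerable c \<Longrightarrow> c 0 \<in> pts (steer c)"
  by (auto simp: steerable_def less_imp_le)

text \<open>The quantifier over \<open>\<epsilon>\<close> in the definition, shared by all indices, is traded for separate limits, to
which subsequences and uniqueness of limits apply.\<close>

lemma P1_steerD:
  assumes "P1 (steer c) x"
  obtains r y where "r \<ge> 1" "y 1 = x"
    "\<And>i. 1 \<le> i \<Longrightarrow> i < r \<Longrightarrow> (\<lambda>n. maps (steer c) (n * r + i) (y i)) \<longlonglongrightarrow> y (i + 1)"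
    "(\<lambda>n. maps (steer c) (n * r) (y r)) \<longlonglongrightarrow> y 1"
proof -
  obtain r y where ry: "r \<ge> 1" "y 1 = x" and
    *: "\<forall>e>0. \<exists>N\<ge>1. \<forall>n\<ge>N.
        (\<forall>i. 1 \<le> i \<and> i < r \<longrightarrow> dist (maps (steer c) (n * r + i) (y i)) (y (i + 1)) < e) \<and>
        dist (maps (steer c) (n * r) (y r)) (y 1) < e"
    using assms unfolding P1_def steer_simps(2) by blast
  show thesis
  proof (rule that[of r y, OF ry])
    show "(\<lambda>n. maps (steer c) (n * r) (y r)) \<longlonglongrightarrow> y 1"
      unfolding lim_sequentially using * by meson
    show "(\<lambda>n. maps (steer c) (n * r + i) (y i)) \<longlonglongrightarrow> y (i + 1)" if "1 \<le> i" "i < r" for i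
      unfolding lim_sequentially using * that by meson
  qed
qed

lemma P5_steerD:
  assumes "steerable c" "P5 (steer c) (c 0)"
  obtains r y where "r \<ge> 1" "\<And>i. i < r \<Longrightarrow> (\<lambda>n. c (n * r + i)) \<longlonglongrightarrow> y (i + 1)"
proof -
  obtain r y where r: "r \<ge> 1" and
    *: "\<forall>e>0. \<exists>n0>0. \<forall>n\<ge>n0. \<forall>i<r. dist (c (n * r + i)) (y (i + 1)) < e"
    using assms(2) unfolding P5_def steer_simps(2) steer_orbit[OF assms(1)] by blast
  show thesis
    by (rule that[of r y, OF r]) (unfold lim_sequentially, use * in blast)
qed

lemma P5_steerI:
  assumes c: "steerable c" and lim: "c \<longlonglongrightarrow> L"
  shows "P5 (steer c) (c 0)"
proof -
  have "0 \<le> L" "L \<le> 1"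
    using c lim by (auto simp: steerable_def less_imp_le intro: LIMSEQ_le_const LIMSEQ_le_const2)
  moreover have "\<exists>n0>0. \<forall>n\<ge>n0. dist (c n) L < e" if "e > 0" for e
  proof -
    obtain N where "\<forall>n\<ge>N. dist (c n) L < e" using lim \<open>e > 0\<close> unfolding lim_sequentially by blast
    then show ?thesis by (intro exI[of _ "Suc N"]) simp
  qed
  ultimately show ?thesis
    unfolding P5_def steer_orbit[OF c] by (intro exI[of _ 1] exI[of _ "\<lambda>_. L"]) auto
qed

text \<open>The limit map is the identity, so every point is pseudo-periodic with \<open>r = 1\<close>.\<close>

lemma P1_steerI:
  assumes x: "x \<in> pts (steer c)" and t: "steer_coeff c \<longlonglongrightarrow> 0"
  shows "P1 (steer c) x"
proof -
  have "(\<lambda>n. maps (steer c) n x) \<longlonglongrightarrow> x + 0 * (x * (1 - x))"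
    unfolding steer_simps by (intro tendsto_intros t)
  then have lim: "(\<lambda>n. maps (steer c) n x) \<longlonglongrightarrow> x" by simp
  have "\<exists>N\<ge>1. \<forall>n\<ge>N. dist (maps (steer c) n x) x < e" if "e > 0" for e
  proof -
    obtain N where "\<forall>n\<ge>N. dist (maps (steer c) n x) x < e"
      using lim \<open>e > 0\<close> unfolding lim_sequentially by blast
    then show ?thesis by (intro exI[of _ "Suc N"]) simp
  qed
  then show ?thesis
    using x unfolding P1_def by (intro exI[of _ 1] exI[of _ "\<lambda>_. x"]) auto
qed

text \<open>Within distance 1/10 of 1/2 the product \<open>x * (1 - x)\<close> is at least 1/4 - 1/100, which exceeds 1/5,
the largest distance between two terms. Thus every sequence in this band can be steered, and the
parameters are controlled by the increments.\<close>

lemma near_half_coeff: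
  fixes c :: "nat \<Rightarrow> real"
  assumes "\<forall>n. \<bar>c n - 1/2\<bar> \<le> 1/10"
  shows "\<bar>c (Suc n) - c n\<bar> \<le> c n * (1 - c n)" "c n * (1 - c n) \<ge> 6/25"
proof -
  have "(c n - 1/2)\<^sup>2 \<le> (1/10)\<^sup>2"
    using power_mono[OF assms[THEN spec, of n] abs_ge_zero, of 2] by (simp only: power2_abs)
  then show *: "c n * (1 - c n) \<ge> 6/25"
    by (simp add: power2_eq_square algebra_simps)
  show "\<bar>c (Suc n) - c n\<bar> \<le> c n * (1 - c n)"
    using * assms[THEN spec, of n] assms[THEN spec, of "Suc n"] by linarith
qed

lemma near_half_steerable:
  fixes c :: "nat \<Rightarrow> real"
  assumes "\<forall>n. \<bar>c n - 1/2\<bar> \<le> 1/10"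
  shows "steerable c"
  unfolding steerable_def
proof (intro allI conjI)
  fix n
  show "0 < c n" "c n < 1" using assms[THEN spec, of n] by linarith+
qed (rule near_half_coeff[OF assms])

lemma near_half_coeff_tendsto_0:
  fixes c :: "nat \<Rightarrow> real"
  assumes c: "\<forall>n. \<bar>c n - 1/2\<bar> \<le> 1/10" and lim: "(\<lambda>n. c (Suc n) - c n) \<longlonglongrightarrow> 0"
  shows "steer_coeff c \<longlonglongrightarrow> 0"
proof -
  have "norm (steer_coeff c (Suc n)) \<le> norm (c (Suc n) - c n) * 5" for n
  proof -
    have p: "c n * (1 - c n) \<ge> 1/5" using near_half_coeff(2)[OF c, of n] by linarith
    then have "\<bar>c (Suc n) - c n\<bar> * 1 \<le> \<bar>c (Suc n) - c n\<bar> * (5 * (c n * (1 - c n)))"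
      by (intro mult_left_mono) auto
    moreover have "\<bar>c n * (1 - c n)\<bar> = c n * (1 - c n)" "0 < c n * (1 - c n)"
      using p by linarith+
    ultimately show ?thesis
      unfolding steer_coeff_def real_norm_def abs_divide diff_Suc_1
      by (simp only: pos_divide_le_eq mult_1_right mult.assoc)
  qed
  then have "(\<lambda>n. steer_coeff c (Suc n)) \<longlonglongrightarrow> 0"
    by (intro Lim_null_comparison[OF _ tendsto_mult_left_zero[OF tendsto_norm_zero[OF lim]]] always_eventually)
       blast
  then show ?thesis by (rule LIMSEQ_imp_Suc)
qed

section \<open>The separating orbits\<close>

text \<open>The phase grows logarithmically, so the increments tend to 0, yet doubling \<open>n \<ge> 1\<close> always advances the
phase by a quarter turn. Hence no subsequence along the multiples of a fixed \<open>r\<close> converges. As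
\<open>log 2 0 = log 2 1 = 0\<close>, the values at 0 and 1 agree, so the orbit returns to its start at time 1.\<close>

definition log_wave :: "nat \<Rightarrow> real" where
  "log_wave n = 1/2 + sin (pi / 2 * log 2 (real n)) / 10"

lemma log_wave_near_half: "\<forall>n. \<bar>log_wave n - 1/2\<bar> \<le> 1/10"
  by (simp add: log_wave_def)

lemma log_wave_slow: "(\<lambda>n. log_wave (Suc n) - log_wave n) \<longlonglongrightarrow> 0"
proof -
  have sin_lip: "\<bar>sin a - sin b\<bar> \<le> \<bar>a - b\<bar>" for a b :: real
  proof -
    have "\<bar>sin a - sin b\<bar> = 2 * \<bar>sin ((a - b) / 2)\<bar> * \<bar>cos ((a + b) / 2)\<bar>"
      by (simp add: sin_diff_sin abs_mult)
    also have "\<dots> \<le> 2 * \<bar>(a - b) / 2\<bar> * 1"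
      by (intro mult_mono abs_sin_x_le_abs_x mult_nonneg_nonneg) auto
    finally show ?thesis by simp
  qed
  define K where "K = pi / (20 * ln 2)"
  have lim: "(\<lambda>n. ln (real n + 1) - ln (real n)) \<longlonglongrightarrow> 0"
    by real_asymp
  have null: "(\<lambda>n. norm (K * (ln (real n + 1) - ln (real n)))) \<longlonglongrightarrow> 0"
    using tendsto_norm[OF tendsto_mult_right_zero[OF lim, of K]] by simp
  have phase: "pi / 2 * (u / ln 2) - pi / 2 * (v / ln 2) = 10 * (K * (u - v))" for u v
    by (simp add: K_def field_simps)
  have tenth: "(1/2 + a / 10) - (1/2 + b / 10) = (a - b) / 10" for a b :: real
    by simp
  show ?thesis
  proof (rule Lim_null_comparison[OF always_eventually null], rule allI)
    fix n
    have "norm (log_wave (Suc n) - log_wave n)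
        = \<bar>sin (pi / 2 * log 2 (real (Suc n))) - sin (pi / 2 * log 2 (real n))\<bar> / 10"
      unfolding log_wave_def tenth real_norm_def abs_divide by simp
    also have "\<dots> \<le> \<bar>pi / 2 * log 2 (real (Suc n)) - pi / 2 * log 2 (real n)\<bar> / 10"
      by (intro divide_right_mono sin_lip) simp
    also have "\<dots> = norm (K * (ln (real n + 1) - ln (real n)))"
      unfolding log_def phase abs_mult real_norm_def by (simp add: add.commute)
    finally show "norm (log_wave (Suc n) - log_wave n) \<le> norm (K * (ln (real n + 1) - ln (real n)))" .
  qed
qed

text \<open>Along \<open>m = 2 ^ k\<close> the rescaled wave is the sine of an angle that advances by a right angle with \<open>k\<close>.
Two steps change the sign, so a limit must be 0; but two consecutive values are sine and cosine of the
same angle, and their squares add up to 1.\<close>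

lemma log_wave_no_limit:
  assumes r: "r \<ge> 1"
  shows "\<not> (\<lambda>m. log_wave (m * r)) \<longlonglongrightarrow> L"
proof
  assume lim: "(\<lambda>m. log_wave (m * r)) \<longlonglongrightarrow> L"
  define s where "s k = sin (pi / 2 * real k + pi / 2 * log 2 (real r))" for k :: nat
  have "filterlim (\<lambda>k. 2 ^ k :: nat) at_top sequentially"
    by (rule filterlim_subseq) (simp add: strict_mono_def)
  from filterlim_compose[OF lim this]
  have "(\<lambda>k. (log_wave (2 ^ k * r) - 1/2) * 10) \<longlonglongrightarrow> (L - 1/2) * 10"
    by (intro tendsto_intros)
  moreover have "(log_wave (2 ^ k * r) - 1/2) * 10 = s k" for k
    using r by (simp add: log_wave_def s_def log_mult log_nat_power algebra_simps)
  ultimately have s: "s \<longlonglongrightarrow> (L - 1/2) * 10" by simp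
  have s2: "s (k + 2) = - s k" for k
  proof -
    have "pi / 2 * real (k + 2) + pi / 2 * log 2 (real r)
        = (pi / 2 * real k + pi / 2 * log 2 (real r)) + pi"
      by (simp add: algebra_simps)
    then show ?thesis unfolding s_def by (simp only: sin_periodic_pi)
  qed
  have "(\<lambda>k. - s k) \<longlonglongrightarrow> (L - 1/2) * 10"
    using LIMSEQ_ignore_initial_segment[OF s, of 2] unfolding s2 .
  from LIMSEQ_unique[OF this tendsto_minus[OF s]] have "(L - 1/2) * 10 = 0" by simp
  with s have s0: "s \<longlonglongrightarrow> 0" by (simp only:)
  have "s (Suc k) = cos (pi / 2 * real k + pi / 2 * log 2 (real r))" for k
  proof -
    have "pi / 2 * real (Suc k) + pi / 2 * log 2 (real r)
        = (pi / 2 * real k + pi / 2 * log 2 (real r)) + pi / 2"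
      by (simp add: algebra_simps)
    then show ?thesis unfolding s_def by (simp only: sin_add) simp
  qed
  then have "(s k)\<^sup>2 + (s (Suc k))\<^sup>2 = 1" for k
    by (simp add: s_def)
  moreover have "(\<lambda>k. (s k)\<^sup>2 + (s (Suc k))\<^sup>2) \<longlonglongrightarrow> 0\<^sup>2 + 0\<^sup>2"
    by (intro tendsto_intros s0 LIMSEQ_Suc)
  ultimately have "(\<lambda>k::nat. 1::real) \<longlonglongrightarrow> 0" by simp
  then show False by (simp add: LIMSEQ_const_iff)
qed

lemma ex_P1_P5_not_P3:
  "\<exists>S\<in>(unif_conv_nds :: real nds set). \<exists>x\<in>pts S. P1 S x \<and> P5 S x \<and> \<not> P3 S x"
proof -
  define c :: "nat \<Rightarrow> real" where "c n = (if n = 0 then 1/2 else 3/5)" for n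
  have near: "\<forall>n. \<bar>c n - 1/2\<bar> \<le> 1/10" by (simp add: c_def)
  note st = near_half_steerable[OF near]
  have cS: "(\<lambda>n. c (Suc n)) \<longlonglongrightarrow> 3/5" by (simp add: c_def)
  then have lim: "c \<longlonglongrightarrow> 3/5" by (rule LIMSEQ_imp_Suc)
  have "steer_coeff c \<longlonglongrightarrow> 0"
    using tendsto_diff[OF cS lim] by (intro near_half_coeff_tendsto_0 near) simp
  then have "steer c \<in> unif_conv_nds" "P1 (steer c) (c 0)"
    by (rule steer_in_unif_conv_nds[OF st], rule P1_steerI[OF steer_start[OF st]])
  moreover have "\<not> P3 (steer c) (c 0)"
    unfolding P3_def steer_orbit[OF st] by (simp add: c_def)
  ultimately show ?thesis using steer_start[OF st] P5_steerI[OF st lim] by blast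
qed

lemma ex_P1_P3_not_P5:
  "\<exists>S\<in>(unif_conv_nds :: real nds set). \<exists>x\<in>pts S. P1 S x \<and> P3 S x \<and> \<not> P5 S x"
proof -
  note st = near_half_steerable[OF log_wave_near_half]
  have "P3 (steer log_wave) (log_wave 0)"
    unfolding P3_def steer_orbit[OF st] by (intro exI[of _ "1::nat"]) (simp add: log_wave_def log_def)
  moreover have "\<not> P5 (steer log_wave) (log_wave 0)"
  proof
    assume "P5 (steer log_wave) (log_wave 0)"
    then obtain r y where r: "r \<ge> 1"
      and lim: "\<And>i. i < r \<Longrightarrow> (\<lambda>n. log_wave (n * r + i)) \<longlonglongrightarrow> y (i + 1)"
      by (rule P5_steerD[OF st]) (rule that)
    from lim[of 0] log_wave_no_limit[OF r] r show False by simp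
  qed
  moreover have coeff: "steer_coeff log_wave \<longlonglongrightarrow> 0"
    by (rule near_half_coeff_tendsto_0[OF log_wave_near_half log_wave_slow])
  have "steer log_wave \<in> unif_conv_nds" "P1 (steer log_wave) (log_wave 0)"
    by (rule steer_in_unif_conv_nds[OF st coeff], rule P1_steerI[OF steer_start[OF st] coeff])
  ultimately show ?thesis using steer_start[OF st] by blast
qed

text \<open>From time 2 on every map is squaring, so the points of a pseudo-periodic cycle would be related by
squaring exactly. Starting from 1/2 the squares stay in \<open>(0, 1/2]\<close>, and squaring the last of them to
return to 1/2 is impossible.\<close>

lemma ex_P3_P5_not_P1:
  "\<exists>S\<in>(unif_conv_nds :: real nds set). \<exists>x\<in>pts S. P3 S x \<and> P5 S x \<and> \<not> P1 S x"
proof -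
  \<comment> \<open>Truncated subtraction makes \<open>c 0 = c 1 = 1/2\<close>, the single return; afterwards each term is squared.\<close>
  define c :: "nat \<Rightarrow> real" where "c n = (1/2) ^ (2 ^ (n - 1))" for n
  have c_Suc: "c (Suc (Suc n)) = (c (Suc n))\<^sup>2" for n
    by (simp add: c_def ac_simps flip: power_mult)
  have bd: "0 < c n \<and> c n < 1" for n
    by (simp add: c_def power_less_one_iff)
  have "\<bar>c (Suc n) - c n\<bar> \<le> c n * (1 - c n)" for n
  proof (cases n)
    case (Suc m)
    have "(c n)\<^sup>2 \<le> c n" using bd[of n] by (simp add: power2_eq_square mult_left_le)
    then show ?thesis using c_Suc[of m] Suc by (simp add: power2_eq_square algebra_simps)
  qed (simp add: c_def)
  then have st: "steerable c" using bd by (simp add: steerable_def)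
  \<comment> \<open>The parameter -1 gives \<open>x - x * (1 - x)\<close>, the squaring map.\<close>
  have coeff: "steer_coeff c n = -1" if "n \<ge> 2" for n
  proof -
    obtain m where m: "n = Suc (Suc m)"
      using \<open>n \<ge> 2\<close> by (metis Suc_le_D numeral_2_eq_2 Suc_le_mono)
    have "c (Suc m) \<noteq> 0" "1 - c (Suc m) \<noteq> 0" using bd[of "Suc m"] by auto
    then show ?thesis
      by (simp add: steer_coeff_def m c_Suc power2_eq_square divide_eq_eq algebra_simps)
  qed
  have sq: "maps (steer c) n x = x\<^sup>2" if "n \<ge> 2" for n x
    using coeff[OF that] by (simp add: power2_eq_square algebra_simps)
  have "steer_coeff c \<longlonglongrightarrow> -1"
    by (rule tendsto_eventually, rule eventually_mono[OF eventually_ge_at_top[of 2]]) (rule coeff)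
  then have un: "steer c \<in> unif_conv_nds" by (rule steer_in_unif_conv_nds[OF st])
  have "(\<lambda>n. c (Suc n)) \<longlonglongrightarrow> 0"
  proof (rule Lim_null_comparison[OF always_eventually])
    show "\<forall>n. norm (c (Suc n)) \<le> (1/2) ^ n"
      by (auto simp: c_def intro!: power_decreasing less_imp_le[OF less_exp])
  qed (simp add: LIMSEQ_realpow_zero)
  then have "c \<longlonglongrightarrow> 0" by (rule LIMSEQ_imp_Suc)
  then have "P5 (steer c) (c 0)" by (rule P5_steerI[OF st])
  moreover have "P3 (steer c) (c 0)"
    unfolding P3_def steer_orbit[OF st] by (intro exI[of _ 1]) (simp add: c_def)
  moreover have "\<not> P1 (steer c) (c 0)"
  proof
    assume "P1 (steer c) (c 0)"
    then obtain r y where r: "r \<ge> 1" "y 1 = c 0"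
      and step: "\<And>i. 1 \<le> i \<Longrightarrow> i < r \<Longrightarrow> (\<lambda>n. maps (steer c) (n * r + i) (y i)) \<longlonglongrightarrow> y (i + 1)"
      and last: "(\<lambda>n. maps (steer c) (n * r) (y r)) \<longlonglongrightarrow> y 1"
      by (rule P1_steerD) (rule that)
    have late: "eventually (\<lambda>n. maps (steer c) (n * r + i) z = z\<^sup>2) sequentially" for i z
    proof (rule eventually_mono[OF eventually_ge_at_top[of 2]])
      fix n :: nat assume "2 \<le> n"
      then have "2 \<le> n * r + i" using mult_le_mono[OF \<open>2 \<le> n\<close> r(1)] by simp
      then show "maps (steer c) (n * r + i) z = z\<^sup>2" by (rule sq)
    qed
    have y_step: "y (i + 1) = (y i)\<^sup>2" if "1 \<le> i" "i < r" for i
      using LIMSEQ_unique[OF step[OF that] tendsto_eventually[OF late]] .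
    have y_last: "y 1 = (y r)\<^sup>2"
      using LIMSEQ_unique[OF last tendsto_eventually] late[of 0 "y r"] by simp
    have "0 < y i \<and> y i \<le> 1/2" if "1 \<le> i" "i \<le> r" for i
      using that
    proof (induction i rule: dec_induct)
      case base
      then show ?case using r(2) by (simp add: c_def)
    next
      case (step n)
      then have "0 < y n" "y n \<le> 1/2" "y (Suc n) = (y n)\<^sup>2" using y_step[of n] by auto
      moreover from this have "y n * y n \<le> 1/2 * 1" by (intro mult_mono) auto
      ultimately show ?case by (simp add: power2_eq_square)
    qed
    from this[OF r(1)] have "y r * y r \<le> 1/2 * (1/2)" by (intro mult_mono) auto
    then show False using y_last r(2) by (simp add: c_def power2_eq_square)
  qed
  ultimately show ?thesis using un steer_start[OF st] by blast
qed

text \<open>The excursion to 3/5 at time 1 is never repeated, because every later excursion is smaller.\<close>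

lemma ex_P4_not_P2:
  "\<exists>S\<in>(unif_conv_nds :: real nds set). \<exists>x\<in>pts S. P4 S x \<and> \<not> P2 S x"
proof -
  define c :: "nat \<Rightarrow> real" where "c n = (if even n then 1/2 else 1/2 + 1 / (10 * real n))" for n
  have near: "\<forall>n. \<bar>c n - 1/2\<bar> \<le> 1/10"
    by (auto simp: c_def divide_simps elim: oddE)
  note st = near_half_steerable[OF near]
  have "(\<lambda>n. c n - 1/2) \<longlonglongrightarrow> 0"
  proof (rule Lim_null_comparison[OF always_eventually])
    show "\<forall>n. norm (c n - 1/2) \<le> 1 / (10 * real n)" by (simp add: c_def)
    show "(\<lambda>n. 1 / (10 * real n)) \<longlonglongrightarrow> 0" by real_asymp
  qed
  then have lim: "c \<longlonglongrightarrow> 1/2" by (simp add: LIM_zero_iff)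
  have "steer_coeff c \<longlonglongrightarrow> 0"
    using tendsto_diff[OF LIMSEQ_Suc[OF lim] lim] by (intro near_half_coeff_tendsto_0 near) simp
  then have "steer c \<in> unif_conv_nds" by (rule steer_in_unif_conv_nds[OF st])
  moreover have "P4 (steer c) (c 0)"
    unfolding P4_def steer_orbit[OF st] by (intro exI[of _ 2]) (simp add: c_def)
  moreover have "\<not> P2 (steer c) (c 0)"
  proof
    assume "P2 (steer c) (c 0)"
    then obtain r where "r \<ge> 1" "c (1 + r) = c 1"
      unfolding P2_def steer_orbit[OF st] by blast
    then show False by (auto simp: c_def divide_simps split: if_splits)
  qed
  ultimately show ?thesis using steer_start[OF st] by blast
qed

text \<open>For \<open>r \<ge> 2\<close>, both properties force convergence of the values at the odd times \<open>2 * m * r + 1\<close>, which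
are \<open>log_wave (m * r)\<close>. When \<open>r = 1\<close> there is no offset 1, and the subsequence of all odd times takes
its place. For \<^term>\<open>P1\<close> the point \<open>y 1 = 1/2\<close> is exactly where the orbit sits before an odd time, so the single
map at that time also produces a value of the wave.\<close>

lemma ex_P4_not_P1_not_P5:
  "\<exists>S\<in>(all_nds :: real nds set). \<exists>x\<in>pts S. P4 S x \<and> \<not> P1 S x \<and> \<not> P5 S x"
proof -
  define c :: "nat \<Rightarrow> real" where "c n = (if even n then 1/2 else log_wave (n div 2))" for n
  have near: "\<forall>n. \<bar>c n - 1/2\<bar> \<le> 1/10"
    using log_wave_near_half by (simp add: c_def)
  note st = near_half_steerable[OF near]
  have c_odd: "c (Suc (2 * k)) = log_wave k" for k by (simp add: c_def)
  have c_odd': "maps (steer c) (Suc (2 * k)) (1/2) = log_wave k" for k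
  proof -
    have "c (2 * k) = 1/2" by (simp add: c_def)
    then show ?thesis using steer_maps_orbit[OF st, of "2 * k"] by (simp only: c_odd)
  qed
  have dbl: "filterlim (\<lambda>m::nat. 2 * m) at_top sequentially"
    by (rule filterlim_subseq) (simp add: strict_mono_def)
  have dblS: "filterlim (\<lambda>m::nat. Suc (2 * m)) at_top sequentially"
    by (rule filterlim_subseq) (simp add: strict_mono_def)
  have "P4 (steer c) (c 0)"
    unfolding P4_def steer_orbit[OF st] by (intro exI[of _ 2]) (simp add: c_def)
  moreover have "\<not> P1 (steer c) (c 0)"
  proof
    assume "P1 (steer c) (c 0)"
    then obtain r y where r: "r \<ge> 1" "y 1 = c 0"
      and step: "\<And>i. 1 \<le> i \<Longrightarrow> i < r \<Longrightarrow> (\<lambda>n. maps (steer c) (n * r + i) (y i)) \<longlonglongrightarrow> y (i + 1)"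
      and last: "(\<lambda>n. maps (steer c) (n * r) (y r)) \<longlonglongrightarrow> y 1"
      by (rule P1_steerD) (rule that)
    have "y 1 = 1/2" using r(2) by (simp add: c_def)
    then have y_odd: "maps (steer c) (Suc (2 * k)) (y 1) = log_wave k" for k
      using c_odd' by (simp only:)
    show False
    proof (cases "r = 1")
      case True
      then have "(\<lambda>m. log_wave (m * 1)) \<longlonglongrightarrow> y 1"
        using filterlim_compose[OF last dblS] y_odd True by (simp del: steer_simps)
      then show False using log_wave_no_limit[of 1] by simp
    next
      case False
      then have "(\<lambda>m. maps (steer c) (2 * m * r + 1) (y 1)) \<longlonglongrightarrow> y (1 + 1)"
        using filterlim_compose[OF step[of 1] dbl] r(1) by (simp del: steer_simps)
      then have "(\<lambda>m. log_wave (m * r)) \<longlonglongrightarrow> y (1 + 1)"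
        using y_odd by (simp add: mult.assoc del: steer_simps)
      then show False using log_wave_no_limit[OF r(1)] by blast
    qed
  qed
  moreover have "\<not> P5 (steer c) (c 0)"
  proof
    assume "P5 (steer c) (c 0)"
    then obtain r y where r: "r \<ge> 1"
      and lim: "\<And>i. i < r \<Longrightarrow> (\<lambda>n. c (n * r + i)) \<longlonglongrightarrow> y (i + 1)"
      by (rule P5_steerD[OF st]) (rule that)
    show False
    proof (cases "r = 1")
      case True
      then have "(\<lambda>m. log_wave (m * 1)) \<longlonglongrightarrow> y 1"
        using filterlim_compose[OF lim[of 0] dblS] c_odd by simp
      then show False using log_wave_no_limit[of 1] by simp
    next
      case False
      then have "(\<lambda>m. c (2 * m * r + 1)) \<longlonglongrightarrow> y (1 + 1)"
        using filterlim_compose[OF lim[of 1] dbl] r by simp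
      then have "(\<lambda>m. log_wave (m * r)) \<longlonglongrightarrow> y (1 + 1)"
        using c_odd by (simp add: mult.assoc)
      then show False using log_wave_no_limit[OF r] by blast
    qed
  qed
  ultimately show ?thesis using steer_in_all_nds[OF st] steer_start[OF st] by blast
qed

section \<open>The implication table\<close>

lemma implies_in_mono: "C \<subseteq> D \<Longrightarrow> implies_in D P Q \<Longrightarrow> implies_in C P Q"
  by (auto simp: implies_in_def)

lemma implies_in_trans: "implies_in C P Q \<Longrightarrow> implies_in C Q R \<Longrightarrow> implies_in C P R"
  by (auto simp: implies_in_def)

lemma unif_conv_subset: "unif_conv_nds \<subseteq> all_nds"
  by (auto simp: unif_conv_nds_def)

lemma all_nds_implications:
  "implies_in all_nds P2 P1" "implies_in all_nds P2 P4" "implies_in all_nds P2 P5"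
  "implies_in all_nds P4 P3" "implies_in all_nds P2 P3"
  unfolding implies_in_def
  by (simp_all add: P2_imp_P1 P2_imp_P4 P2_imp_P5 P4_imp_P3)

lemma unif_conv_nds_implications:
  "implies_in unif_conv_nds P4 P1" "implies_in unif_conv_nds P4 P5"
  unfolding implies_in_def by (simp_all add: unif_conv_P4_imp_P1 unif_conv_P4_imp_P5)

theorem theorem1:
  shows
    "(implies_in (all_nds :: 'a nds set) P2 P1 \<and>
     implies_in (all_nds :: 'a nds set) P2 P4 \<and>
     implies_in (all_nds :: 'a nds set) P2 P5 \<and>
     implies_in (all_nds :: 'a nds set) P4 P3 \<and>
     implies_in (all_nds :: 'a nds set) P2 P3 \<and>
     \<not> implies_in (all_nds :: real nds set) P1 P2 \<and>
     \<not> implies_in (all_nds :: real nds set) P1 P3 \<and>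
     \<not> implies_in (all_nds :: real nds set) P1 P4 \<and>
     \<not> implies_in (all_nds :: real nds set) P1 P5 \<and>
     \<not> implies_in (all_nds :: real nds set) P3 P1 \<and>
     \<not> implies_in (all_nds :: real nds set) P3 P2 \<and>
     \<not> implies_in (all_nds :: real nds set) P3 P4 \<and>
     \<not> implies_in (all_nds :: real nds set) P3 P5 \<and>
     \<not> implies_in (all_nds :: real nds set) P4 P1 \<and>
     \<not> implies_in (all_nds :: real nds set) P4 P2 \<and>
     \<not> implies_in (all_nds :: real nds set) P4 P5 \<and>
     \<not> implies_in (all_nds :: real nds set) P5 P1 \<and>
     \<not> implies_in (all_nds :: real nds set) P5 P2 \<and>
     \<not> implies_in (all_nds :: real nds set) P5 P3 \<and>
     \<not> implies_in (all_nds :: real nds set) P5 P4) \<and>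
    (implies_in (unif_conv_nds :: 'a nds set) P2 P1 \<and>
     implies_in (unif_conv_nds :: 'a nds set) P2 P4 \<and>
     implies_in (unif_conv_nds :: 'a nds set) P4 P1 \<and>
     implies_in (unif_conv_nds :: 'a nds set) P4 P3 \<and>
     implies_in (unif_conv_nds :: 'a nds set) P4 P5 \<and>
     implies_in (unif_conv_nds :: 'a nds set) P2 P3 \<and>
     implies_in (unif_conv_nds :: 'a nds set) P2 P5 \<and>
     \<not> implies_in (unif_conv_nds :: real nds set) P1 P2 \<and>
     \<not> implies_in (unif_conv_nds :: real nds set) P1 P3 \<and>
     \<not> implies_in (unif_conv_nds :: real nds set) P1 P4 \<and>
     \<not> implies_in (unif_conv_nds :: real nds set) P1 P5 \<and>
     \<not> implies_in (unif_conv_nds :: real nds set) P3 P1 \<and>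
     \<not> implies_in (unif_conv_nds :: real nds set) P3 P2 \<and>
     \<not> implies_in (unif_conv_nds :: real nds set) P3 P4 \<and>
     \<not> implies_in (unif_conv_nds :: real nds set) P3 P5 \<and>
     \<not> implies_in (unif_conv_nds :: real nds set) P4 P2 \<and>
     \<not> implies_in (unif_conv_nds :: real nds set) P5 P1 \<and>
     \<not> implies_in (unif_conv_nds :: real nds set) P5 P2 \<and>
     \<not> implies_in (unif_conv_nds :: real nds set) P5 P3 \<and>
     \<not> implies_in (unif_conv_nds :: real nds set) P5 P4)"
proof -
  let ?A = "all_nds :: real nds set" and ?U = "unif_conv_nds :: real nds set"
  note unif = all_nds_implications[THEN implies_in_mono[OF unif_conv_subset]]
    unif_conv_nds_implications
  have sep: "\<not> implies_in ?U P1 P3" "\<not> implies_in ?U P5 P3" "\<not> implies_in ?U P1 P5"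
    "\<not> implies_in ?U P3 P5" "\<not> implies_in ?U P3 P1" "\<not> implies_in ?U P5 P1"
    "\<not> implies_in ?U P4 P2" "\<not> implies_in ?A P4 P1" "\<not> implies_in ?A P4 P5"
    unfolding implies_in_def
    by (use ex_P1_P5_not_P3 in blast, use ex_P1_P5_not_P3 in blast, use ex_P1_P3_not_P5 in blast,
        use ex_P1_P3_not_P5 in blast, use ex_P3_P5_not_P1 in blast, use ex_P3_P5_not_P1 in blast,
        use ex_P4_not_P2 in blast, use ex_P4_not_P1_not_P5 in blast)
      (use ex_P4_not_P1_not_P5 in blast)
  \<comment> \<open>An implication excluded here would compose with a valid one to give an implication that is already excluded.\<close>
  have P4: "\<not> implies_in ?U P1 P4" "\<not> implies_in ?U P5 P4" "\<not> implies_in ?U P3 P4"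
    by (rule sep(1)[THEN contrapos_nn], erule implies_in_trans[OF _ unif(4)])
      (rule sep(2)[THEN contrapos_nn], erule implies_in_trans[OF _ unif(4)],
        rule sep(5)[THEN contrapos_nn], erule implies_in_trans[OF _ unif(6)])
  have P2: "\<not> implies_in ?U P1 P2" "\<not> implies_in ?U P5 P2" "\<not> implies_in ?U P3 P2"
    by (rule P4[THEN contrapos_nn], erule implies_in_trans[OF _ unif(2)])+
  note sepU = sep(1-7) P4 P2
  have sepA: "\<not> implies_in ?A P Q" if "\<not> implies_in ?U P Q" for P Q
    using that by (rule contrapos_nn) (rule implies_in_mono[OF unif_conv_subset])
  show ?thesis
    by (intro conjI; (rule all_nds_implications unif sep sepU | rule sepA, rule sepU))
qed

end
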